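(* Let $X$ be a nonempty set, $Y$ a nonempty subset of $X$, and $f\in\overline{\Omega}(X,Y)$. Then $f\in\operatorname{ureg}(\overline{\Omega}(X,Y))$ if and only if $|X\setminus T_f|=|X\setminus Xf|$ for some transversal $T_f$ of $\ker(f)$ such that $Y\subseteq T_f$.
   Context: $T(X)$ is the semigroup of all maps $X\to X$ under composition; maps are written on the right and composed from left to right, so $x(fg)=(xf)g$, and for $B\subseteq X$, $Bf=\{xf\colon x\in B\}$. Let $\overline{\Omega}(X,Y)=\{f\in T(X)\colon Yf=Y\}$, a subsemigroup of $T(X)$ containing the identity map. For a semigroup $S$ with identity, $U(S)$ is the set of all units of $S$; an element $a\in S$ is unit-regular if $aba=a$ for some $b\in U(S)$, and $\operatorname{ureg}(S)$ is the set of all unit-regular elements of $S$. $\ker(f)$ is the equivalence relation on $X$ with $(a,b)\in\ker(f)$ iff $af=bf$. A transversal of an equivalence relation on $X$ is a subset of $X$ containing exactly one element of each equivalence class. $|A|$ denotes the cardinality of $A$. *)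

theory Defs
  imports "HOL-Algebra.Group" "HOL-Library.FuncSet" "HOL-Library.Equipollence"
begin

text \<open>
  Maps \<open>X \<rightarrow> X\<close> are extensional functions, so that equality in \<open>carrier\<close> is equality of maps on \<open>X\<close>.
  Since maps act on the right, the product \<open>f \<otimes> g\<close> means first \<open>f\<close>, then \<open>g\<close>;
  \<open>compose X g f\<close> sends \<open>x\<close> to \<open>g (f x)\<close>.
\<close>

definition full_transformations :: "'a set \<Rightarrow> ('a \<Rightarrow> 'a) monoid" where
  "full_transformations X =
    \<lparr>carrier = X \<rightarrow>\<^sub>E X, mult = (\<lambda>f g. compose X g f), one = (\<lambda>x\<in>X. x)\<rparr>"

definition Omega_bar :: "'a set \<Rightarrow> 'a set \<Rightarrow> ('a \<Rightarrow> 'a) monoid" where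
  "Omega_bar X Y =
    (full_transformations X)\<lparr>carrier := {f \<in> carrier (full_transformations X). f ` Y = Y}\<rparr>"

definition ureg :: "('a, 'b) monoid_scheme \<Rightarrow> 'a set" where
  "ureg S = {a \<in> carrier S. \<exists>b\<in>Units S. a \<otimes>\<^bsub>S\<^esub> b \<otimes>\<^bsub>S\<^esub> a = a}"

definition map_ker :: "'a set \<Rightarrow> ('a \<Rightarrow> 'b) \<Rightarrow> 'a rel" where
  "map_ker X f = {(a, b) \<in> X \<times> X. f a = f b}"

definition is_transversal :: "'a set \<Rightarrow> 'a rel \<Rightarrow> 'a set \<Rightarrow> bool" where
  "is_transversal X r T \<longleftrightarrow> T \<subseteq> X \<and> (\<forall>C\<in>X // r. \<exists>!t. t \<in> T \<inter> C)"

lemma equiv_map_ker: "equiv X (map_ker X f)"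
  unfolding map_ker_def by (auto intro!: equivI refl_onI symI transI)

lemma monoid_full_transformations: "monoid (full_transformations X)"
  by (rule monoidI) (auto simp: full_transformations_def compose_def restrict_def PiE_iff
      extensional_def fun_eq_iff)

lemma monoid_Omega_bar:
  assumes "Y \<subseteq> X"
  shows "monoid (Omega_bar X Y)"
proof (rule monoidI)
  fix f g
  assume fg: "f \<in> carrier (Omega_bar X Y)" "g \<in> carrier (Omega_bar X Y)"
  have "compose X g f ` Y = g ` f ` Y"
    using assms by (auto simp: compose_def image_iff subset_iff)
  then show "f \<otimes>\<^bsub>Omega_bar X Y\<^esub> g \<in> carrier (Omega_bar X Y)"
    using fg by (auto simp: Omega_bar_def full_transformations_def compose_def)
next
  have "(\<lambda>x\<in>X. x) ` Y = Y"
    using assms by (auto simp: image_iff subset_iff)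
  then show "\<one>\<^bsub>Omega_bar X Y\<^esub> \<in> carrier (Omega_bar X Y)"
    by (auto simp: Omega_bar_def full_transformations_def)
qed (auto simp: Omega_bar_def full_transformations_def compose_def restrict_def PiE_iff
    extensional_def fun_eq_iff)

end

theory Submission
  imports Defs
begin

text \<open>
  A unit \<open>b\<close> of \<open>Omega_bar X Y\<close> is a permutation of \<open>X\<close> that maps \<open>Y\<close> onto itself
  (\<open>Units_Omega_bar\<close>), and the equation \<open>f b f = f\<close> says that \<open>b\<close> restricted to the image
  of \<open>f\<close> is a section of \<open>f\<close>, that is, a choice of one preimage for each value of \<open>f\<close>. The image
  of such a section is precisely a transversal \<open>T\<close> of the kernel
  (\<open>is_transversal_map_ker_iff\<close>). So everything depends on when a section can be extended to a
  permutation of \<open>X\<close>: it already maps \<open>f ` X\<close> bijectively onto \<open>T\<close>, hence an extension exists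
  if and only if the complements \<open>X - f ` X\<close> and \<open>X - T\<close> are equipotent.

  The set \<open>Y\<close> takes care of itself. Since \<open>f\<close> maps \<open>Y\<close> onto \<open>Y\<close>, the section with image
  \<open>T\<close> maps \<open>Y\<close> onto \<open>Y\<close> as soon as \<open>Y \<subseteq> T\<close>; conversely, a unit \<open>b\<close> gives \<open>T = b ` f ` X\<close>,
  which contains \<open>b ` f ` Y = Y\<close>.
\<close>

lemma carrier_Omega_bar: "carrier (Omega_bar X Y) = {f \<in> X \<rightarrow>\<^sub>E X. f ` Y = Y}"
  by (simp add: Omega_bar_def full_transformations_def)

lemma mult_Omega_bar: "f \<otimes>\<^bsub>Omega_bar X Y\<^esub> g = compose X g f"
  by (simp add: Omega_bar_def full_transformations_def)

lemma one_Omega_bar: "\<one>\<^bsub>Omega_bar X Y\<^esub> = (\<lambda>x\<in>X. x)"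
  by (simp add: Omega_bar_def full_transformations_def)

text \<open>
  A permutation in \<open>Omega_bar X Y\<close> is automatically a unit there: it maps \<open>Y\<close> onto all of \<open>Y\<close>,
  and therefore so does its inverse. This would fail if only \<open>b ` Y \<subseteq> Y\<close> were known.
\<close>

lemma Units_Omega_bar:
  assumes "Y \<subseteq> X"
  shows "Units (Omega_bar X Y) = {b \<in> X \<rightarrow>\<^sub>E X. bij_betw b X X \<and> b ` Y = Y}"
proof (intro equalityI subsetI)
  fix b assume "b \<in> Units (Omega_bar X Y)"
  then obtain c where b: "b \<in> X \<rightarrow>\<^sub>E X" "b ` Y = Y" and c: "c \<in> X \<rightarrow>\<^sub>E X"
    and cb: "compose X b c = (\<lambda>x\<in>X. x)" and bc: "compose X c b = (\<lambda>x\<in>X. x)"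
    by (auto simp: Units_def carrier_Omega_bar mult_Omega_bar one_Omega_bar)
  have "b (c x) = x" "c (b x) = x" if "x \<in> X" for x
    using that fun_cong[OF cb, of x] fun_cong[OF bc, of x] by (simp_all add: compose_eq)
  then have "bij_betw b X X"
    using b c by (intro bij_betwI[where g = c]) auto
  then show "b \<in> {b \<in> X \<rightarrow>\<^sub>E X. bij_betw b X X \<and> b ` Y = Y}"
    using b by blast
next
  fix b assume "b \<in> {b \<in> X \<rightarrow>\<^sub>E X. bij_betw b X X \<and> b ` Y = Y}"
  then have b: "b \<in> X \<rightarrow>\<^sub>E X" "bij_betw b X X" "b ` Y = Y" by auto
  define c where "c = restrict (inv_into X b) X"
  have c: "c \<in> X \<rightarrow>\<^sub>E X"
    using bij_betw_inv_into[OF b(2)] by (auto simp: c_def bij_betw_def)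
  have left: "c (b x) = x" and right: "b (c x) = x" if "x \<in> X" for x
    using that b(1) bij_betw_inv_into_left[OF b(2)] bij_betw_inv_into_right[OF b(2)]
    by (auto simp: c_def PiE_iff)
  have "c ` b ` Y = Y"
    using assms left by (simp add: image_image subset_iff)
  then have cY: "c ` Y = Y" using b(3) by simp
  have cb: "compose X b c = (\<lambda>x\<in>X. x)" and bc: "compose X c b = (\<lambda>x\<in>X. x)"
    using left right by (auto simp: compose_def)
  show "b \<in> Units (Omega_bar X Y)"
    using b c cY cb bc
    by (auto simp: Units_def carrier_Omega_bar mult_Omega_bar one_Omega_bar)
qed

text \<open>
  The classes of the kernel are the nonempty fibres of \<open>f\<close>. That \<open>T\<close> meets each of them at least
  once is \<open>f ` T = f ` X\<close>, and that it does so at most once is injectivity on \<open>T\<close>.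
\<close>

lemma is_transversal_map_ker_iff:
  "is_transversal X (map_ker X f) T \<longleftrightarrow> T \<subseteq> X \<and> bij_betw f T (f ` X)"
proof -
  have fibre: "map_ker X f `` {x} = {y \<in> X. f y = f x}" if "x \<in> X" for x
    using that by (auto simp: map_ker_def)
  have "is_transversal X (map_ker X f) T \<longleftrightarrow>
      T \<subseteq> X \<and> (\<forall>x\<in>X. \<exists>!t. t \<in> T \<inter> {y \<in> X. f y = f x})"
    by (simp add: is_transversal_def quotient_def fibre)
  also have "\<dots> \<longleftrightarrow> T \<subseteq> X \<and> bij_betw f T (f ` X)"
  proof (rule conj_cong[OF refl])
    assume "T \<subseteq> X"
    then have "(\<exists>!t. t \<in> T \<inter> {y \<in> X. f y = f x}) \<longleftrightarrow> (\<exists>!t. t \<in> T \<and> f t = f x)" for x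
      by (intro arg_cong[where f = Ex1]) auto
    moreover have "bij_betw f T (f ` X) \<longleftrightarrow> (\<forall>x\<in>X. \<exists>!t. t \<in> T \<and> f t = f x)"
    proof
      assume "bij_betw f T (f ` X)"
      then have "inj_on f T" "f ` X = f ` T" by (auto simp: bij_betw_def)
      then show "\<forall>x\<in>X. \<exists>!t. t \<in> T \<and> f t = f x"
        by (force simp: inj_on_def)
    next
      assume unique: "\<forall>x\<in>X. \<exists>!t. t \<in> T \<and> f t = f x"
      have "inj_on f T"
        using unique \<open>T \<subseteq> X\<close> unfolding inj_on_def by blast
      moreover have "f ` T = f ` X"
      proof
        show "f ` T \<subseteq> f ` X" using \<open>T \<subseteq> X\<close> by (rule image_mono)
        show "f ` X \<subseteq> f ` T"
        proof (rule image_subsetI)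
          show "f x \<in> f ` T" if "x \<in> X" for x
            using unique that by (metis imageI)
        qed
      qed
      ultimately show "bij_betw f T (f ` X)" by (simp add: bij_betw_def)
    qed
    ultimately show "(\<forall>x\<in>X. \<exists>!t. t \<in> T \<inter> {y \<in> X. f y = f x}) \<longleftrightarrow>
        bij_betw f T (f ` X)" by simp
  qed
  finally show ?thesis .
qed

lemma ureg_Omega_bar_iff:
  assumes "Y \<subseteq> X" and "f \<in> carrier (Omega_bar X Y)"
  shows "f \<in> ureg (Omega_bar X Y) \<longleftrightarrow>
    (\<exists>b \<in> X \<rightarrow>\<^sub>E X. bij_betw b X X \<and> b ` Y = Y \<and> (\<forall>x\<in>X. f (b (f x)) = f x))"
proof -
  have f: "f \<in> X \<rightarrow>\<^sub>E X" using assms(2) by (simp add: carrier_Omega_bar)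
  have "f \<otimes>\<^bsub>Omega_bar X Y\<^esub> b \<otimes>\<^bsub>Omega_bar X Y\<^esub> f = f \<longleftrightarrow> (\<forall>x\<in>X. f (b (f x)) = f x)" for b
    using f by (auto simp: mult_Omega_bar compose_def fun_eq_iff PiE_iff extensional_def)
  then show ?thesis
    using assms(2) by (auto simp: ureg_def Units_Omega_bar[OF assms(1)])
qed

theorem corollary3p6:
  fixes X Y :: "'a set" and f :: "'a \<Rightarrow> 'a"
  assumes "X \<noteq> {}" and "Y \<noteq> {}" and "Y \<subseteq> X"
    and "f \<in> carrier (Omega_bar X Y)"
  shows "f \<in> ureg (Omega_bar X Y) \<longleftrightarrow>
    (\<exists>T. is_transversal X (map_ker X f) T \<and> Y \<subseteq> T \<and> X - T \<approx> X - f ` X)"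
proof -
  have f: "f \<in> X \<rightarrow> X" "f ` Y = Y" using assms(4) by (auto simp: carrier_Omega_bar)
  show ?thesis
  proof
    assume "f \<in> ureg (Omega_bar X Y)"
    then obtain b where b: "b \<in> X \<rightarrow>\<^sub>E X" "bij_betw b X X" "b ` Y = Y"
      and section_b: "\<forall>x\<in>X. f (b (f x)) = f x"
      by (auto simp: ureg_Omega_bar_iff[OF assms(3,4)])
    define T where "T = b ` f ` X"
    have "T \<subseteq> X" using b f by (auto simp: T_def)
    moreover have "bij_betw f T (f ` X)"
      using section_b by (intro bij_betwI[where g = b]) (auto simp: T_def)
    moreover have "Y \<subseteq> T"
      using assms(3) f(2) b(3) by (metis T_def image_mono)
    moreover have "X - T \<approx> X - f ` X"
    proof -
      have "b ` (X - f ` X) = X - T"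
        using b(2) f(1) inj_on_image_set_diff[of b X X "f ` X"]
        by (auto simp: T_def bij_betw_def)
      then have "bij_betw b (X - f ` X) (X - T)"
        using b(2) by (auto simp: bij_betw_def intro: inj_on_subset)
      then show ?thesis using eqpoll_def eqpoll_sym by blast
    qed
    ultimately show "\<exists>T. is_transversal X (map_ker X f) T \<and> Y \<subseteq> T \<and> X - T \<approx> X - f ` X"
      by (auto simp: is_transversal_map_ker_iff)
  next
    assume "\<exists>T. is_transversal X (map_ker X f) T \<and> Y \<subseteq> T \<and> X - T \<approx> X - f ` X"
    then obtain T where T: "T \<subseteq> X" "bij_betw f T (f ` X)" "Y \<subseteq> T" "X - T \<approx> X - f ` X"
      by (auto simp: is_transversal_map_ker_iff)
    obtain h where h: "bij_betw h (X - f ` X) (X - T)"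
      using T(4) eqpoll_sym eqpoll_def by blast
    \<comment> \<open>Glue the section with image \<open>T\<close> to a bijection between the complements.\<close>
    define b where "b = (\<lambda>x\<in>X. if x \<in> f ` X then inv_into T f x else h x)"
    have b_section: "b x = inv_into T f x" if "x \<in> f ` X" for x
      using that f(1) by (auto simp: b_def)
    have "bij_betw b (f ` X) T"
      using bij_betw_inv_into[OF T(2)] b_section by (simp cong: bij_betw_cong)
    moreover have "bij_betw b (X - f ` X) (X - T)"
    proof (rule bij_betw_cong[THEN iffD2, OF _ h])
      show "b x = h x" if "x \<in> X - f ` X" for x using that by (simp add: b_def)
    qed
    ultimately have "bij_betw b (f ` X \<union> (X - f ` X)) (T \<union> (X - T))"
      by (rule bij_betw_combine) auto
    moreover have "f ` X \<union> (X - f ` X) = X" "T \<union> (X - T) = X" using f(1) T(1) by auto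
    ultimately have bij: "bij_betw b X X" by simp
    have section_b: "f (b (f x)) = f x" if "x \<in> X" for x
      using that T(2) b_section by (simp add: bij_betw_def f_inv_into_f)
    \<comment> \<open>As \<open>Y \<subseteq> T\<close>, the preimage of \<open>f y\<close> chosen by the section is \<open>y\<close> itself.\<close>
    have "b (f y) = y" if "y \<in> Y" for y
      using that T(2,3) assms(3) b_section by (auto simp: bij_betw_def subset_iff)
    then have "b ` f ` Y = Y" by (simp add: image_image)
    then have "b ` Y = Y" using f(2) by simp
    moreover have "b \<in> X \<rightarrow>\<^sub>E X"
      using bij_betw_imp_funcset[OF bij] by (simp add: PiE_def b_def)
    ultimately show "f \<in> ureg (Omega_bar X Y)"
      using bij section_b by (auto simp: ureg_Omega_bar_iff[OF assms(3,4)])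
  qed
qed

end
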